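(* Let $q\geq 3$ and $n\geq 1$ be integers, and let $G=H(n,q)$ be the Hamming graph. Then \[ \left\lfloor\left(1-\tfrac1q\right)n\right\rfloor +1\leq b(G)\leq\left\lfloor\left(1-\tfrac1q\right)n+\tfrac{q+1}2\right\rfloor, \] where $b(G)$ denotes the burning number of $G$.
   Context: For positive integers $n,q$, let $[q]=\{1,\ldots,q\}$. The Hamming graph $H(n,q)$ has vertex set $[q]^n$, and two vertices are adjacent iff they differ in exactly one coordinate; the graph distance $d(u,v)$ is the Hamming distance (number of coordinates in which $u,v$ differ). For a finite graph $G$ with vertex set $V$, a vertex $v$ and an integer $k\geq 0$, let $\Gamma_k(v)=\{u\in V: d(u,v)\leq k\}$. A sequence $(v_1,\ldots,v_b)$ of vertices is a burning sequence of length $b$ if $\Gamma_{b-1}(v_1)\cup\Gamma_{b-2}(v_2)\cup\cdots\cup\Gamma_0(v_b)=V$. The burning number $b(G)$ is the minimum length of a burning sequence of $G$. *)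

theory Defs
  imports Complex_Main "Graph_Theory.Graph_Theory"
begin

context graph
begin

text \<open>Length of a shortest walk: \<open>\<mu>\<close> is taken with unit arc weights. It is extended-real valued,
  being infinite between different components.\<close>

definition graph_dist :: "'a \<Rightarrow> 'a \<Rightarrow> ereal" where
  "graph_dist u v = \<mu> (\<lambda>_. 1) u v"

definition graph_ball :: "nat \<Rightarrow> 'a \<Rightarrow> 'a set" where
  "graph_ball k v = {u \<in> verts G. graph_dist v u \<le> ereal (real k)}"

text \<open>Lists are indexed from 0, so the vertex at position \<open>i\<close> (number \<open>i + 1\<close> of the sequence)
  has radius \<open>b - 1 - i\<close>, where \<open>b\<close> is the length.\<close>

definition burning_sequence :: "'a list \<Rightarrow> bool" where
  "burning_sequence vs \<longleftrightarrow> set vs \<subseteq> verts G \<and>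
     (\<Union>i<length vs. graph_ball (length vs - 1 - i) (vs ! i)) = verts G"

definition burning_number :: nat where
  "burning_number = (LEAST b. \<exists>vs. burning_sequence vs \<and> length vs = b)"

lemma graph_dist_self_le: "v \<in> verts G \<Longrightarrow> graph_dist v v \<le> 0"
  using min_cost_le_walk_cost[of v "[]" v "\<lambda>_. 1"]
  by (simp add: graph_dist_def awalk_Nil_iff zero_ereal_def)

lemma burning_sequence_exists: "\<exists>vs. burning_sequence vs"
proof -
  obtain vs where vs: "set vs = verts G"
    using finite_list[OF finite_verts] by blast
  have "v \<in> (\<Union>i<length vs. graph_ball (length vs - 1 - i) (vs ! i))" if v: "v \<in> verts G" for v
  proof -
    obtain i where i: "i < length vs" "vs ! i = v"
      using v vs by (metis in_set_conv_nth)
    have "graph_dist v v \<le> ereal (real (length vs - 1 - i))"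
      by (rule order_trans[OF graph_dist_self_le[OF v]]) simp
    then show ?thesis
      using i v by (auto simp: graph_ball_def)
  qed
  then have "burning_sequence vs"
    using vs by (auto simp: burning_sequence_def graph_ball_def)
  then show ?thesis ..
qed

lemma burning_number_attained: "\<exists>vs. burning_sequence vs \<and> length vs = burning_number"
  unfolding burning_number_def by (rule LeastI_ex) (use burning_sequence_exists in blast)

end

definition hamming_dist :: "'a list \<Rightarrow> 'a list \<Rightarrow> nat" where
  "hamming_dist u v = card {i. i < length u \<and> u ! i \<noteq> v ! i}"

definition hamming_graph :: "nat \<Rightarrow> nat \<Rightarrow> nat list pair_pre_digraph" where
  "hamming_graph n q =
    (let V = {u. length u = n \<and> set u \<subseteq> {1..q}} in
     \<lparr> pverts = V, parcs = {(u, v). u \<in> V \<and> v \<in> V \<and> hamming_dist u v = 1} \<rparr>)"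

lemma hamming_dist_commute: "length u = length v \<Longrightarrow> hamming_dist u v = hamming_dist v u"
  unfolding hamming_dist_def by (rule arg_cong[of _ _ card]) auto

lemma hamming_dist_triangle:
  assumes "length u = length v" "length v = length w"
  shows "hamming_dist u w \<le> hamming_dist u v + hamming_dist v w"
proof -
  have "hamming_dist u w \<le> card ({i. i < length u \<and> u ! i \<noteq> v ! i} \<union> {i. i < length v \<and> v ! i \<noteq> w ! i})"
    unfolding hamming_dist_def by (rule card_mono) (use assms in auto)
  also have "\<dots> \<le> hamming_dist u v + hamming_dist v w"
    unfolding hamming_dist_def by (rule card_Un_le)
  finally show ?thesis .
qed

lemma pair_graph_hamming_graph: "pair_graph (hamming_graph n q)"
proof -
  let ?V = "{u. length u = n \<and> set u \<subseteq> {1..q}}"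
  have fin: "finite ?V"
    using finite_lists_length_eq[of "{1..q}" n] by (simp add: conj_commute)
  have fin_arcs: "finite {(u, v). u \<in> ?V \<and> v \<in> ?V \<and> hamming_dist u v = 1}"
    by (rule finite_subset[of _ "?V \<times> ?V"]) (use fin in auto)
  have sym: "sym (parcs (hamming_graph n q))"
  proof (rule symI)
    fix u v
    assume "(u, v) \<in> parcs (hamming_graph n q)"
    then have "u \<in> ?V" "v \<in> ?V" "hamming_dist u v = 1"
      by (simp_all add: hamming_graph_def)
    moreover from this have "hamming_dist v u = 1"
      using hamming_dist_commute[of u v] by simp
    ultimately show "(v, u) \<in> parcs (hamming_graph n q)"
      by (simp add: hamming_graph_def)
  qed
  have ends: "arcs_ends (with_proj (hamming_graph n q)) = parcs (hamming_graph n q)"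
    by (simp add: arcs_ends_def arc_to_ends_def)
  show ?thesis
  proof
    show "finite (pverts (hamming_graph n q))" "finite (parcs (hamming_graph n q))"
      using fin fin_arcs by (simp_all add: hamming_graph_def)
    show "symmetric (with_proj (hamming_graph n q))"
      unfolding symmetric_def ends by (rule sym)
    fix e
    assume e: "e \<in> parcs (hamming_graph n q)"
    show "fst e \<in> pverts (hamming_graph n q)" "snd e \<in> pverts (hamming_graph n q)"
      using e by (cases e; simp add: hamming_graph_def)+
    show "fst e \<noteq> snd e"
      using e by (cases e) (auto simp add: hamming_graph_def hamming_dist_def)
  qed
qed

lemma graph_hamming_graph: "graph (with_proj (hamming_graph n q))"
proof -
  interpret pair_graph "hamming_graph n q" by (rule pair_graph_hamming_graph)
  show ?thesis by unfold_locales
qed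

lemma graph_dist_hamming_graph:
  assumes "u \<in> pverts (hamming_graph n q)" "v \<in> pverts (hamming_graph n q)"
  shows "graph.graph_dist (with_proj (hamming_graph n q)) u v = ereal (real (hamming_dist u v))"
proof -
  interpret graph "with_proj (hamming_graph n q)" by (rule graph_hamming_graph)
  have lower: "hamming_dist u v \<le> length p" if "awalk u p v" for p
    using that
  proof (induction p arbitrary: u)
    case Nil
    then show ?case by (simp add: awalk_Nil_iff hamming_dist_def)
  next
    case (Cons e p)
    then have e: "u = fst e" "e \<in> parcs (hamming_graph n q)" and p: "awalk (snd e) p v"
      by (auto simp: awalk_Cons_iff)
    have "v \<in> pverts (hamming_graph n q)"
      using p by (auto dest: awalk_last_in_verts)
    then have "hamming_dist u v \<le> hamming_dist u (snd e) + hamming_dist (snd e) v"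
      using e by (intro hamming_dist_triangle) (auto simp: hamming_graph_def)
    then show ?case
      using e Cons.IH[OF p] by (auto simp: hamming_graph_def)
  qed
  have upper: "\<exists>p. awalk u p v \<and> length p = hamming_dist u v"
    using assms(1)
  proof (induction "hamming_dist u v" arbitrary: u)
    case 0
    then have "u = v"
      using assms(2) by (auto simp: hamming_dist_def hamming_graph_def intro!: nth_equalityI)
    then show ?case
      using 0 by (intro exI[of _ "[]"]) (simp add: awalk_Nil_iff)
  next
    case (Suc d)
    have len: "length u = n" "length v = n"
      using Suc.prems assms(2) by (auto simp: hamming_graph_def)
    have "{i. i < length u \<and> u ! i \<noteq> v ! i} \<noteq> {}"
      using Suc.hyps(2) unfolding hamming_dist_def by (metis card.empty nat.distinct(1))
    then obtain i where i: "i < length u" "u ! i \<noteq> v ! i" by auto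
    define w where "w = u[i := v ! i]"
    have "v ! i \<in> {1..q}"
      using assms(2) i len nth_mem[of i v] by (auto simp: hamming_graph_def simp del: nth_mem)
    then have "set w \<subseteq> {1..q}"
      using Suc.prems set_update_subset_insert[of u i "v ! i"]
      unfolding w_def hamming_graph_def Let_def by force
    then have w: "w \<in> pverts (hamming_graph n q)"
      using len by (simp add: hamming_graph_def w_def)
    have "{j. j < length w \<and> w ! j \<noteq> v ! j} = {j. j < length u \<and> u ! j \<noteq> v ! j} - {i}"
      using i by (auto simp: w_def nth_list_update)
    then have d: "d = hamming_dist w v"
      using Suc.hyps(2) i by (simp add: hamming_dist_def)
    have "{j. j < length u \<and> u ! j \<noteq> w ! j} = {i}"
      using i by (auto simp: w_def nth_list_update)
    then have "(u, w) \<in> parcs (hamming_graph n q)"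
      using Suc.prems w by (simp add: hamming_dist_def hamming_graph_def)
    moreover obtain p where "awalk w p v" "length p = d"
      using Suc.hyps(1)[OF d w] d by auto
    ultimately show ?case
      using Suc.prems Suc.hyps(2) by (intro exI[of _ "(u, w) # p"]) (auto simp: awalk_Cons_iff)
  qed
  have cost: "awalk_cost (\<lambda>_. 1) p = real (length p)" for p :: "(nat list \<times> nat list) list"
    by (induction p) auto
  show ?thesis
    unfolding graph_dist_def
  proof (rule antisym)
    show "\<mu> (\<lambda>_. 1) u v \<le> ereal (real (hamming_dist u v))"
      using upper min_cost_le_walk_cost[of u _ v "\<lambda>_. 1"] by (metis cost)
    show "ereal (real (hamming_dist u v)) \<le> \<mu> (\<lambda>_. 1) u v"
      unfolding \<mu>_def by (rule INF_greatest) (use lower in \<open>auto simp: cost\<close>)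
  qed
qed

end

theory Submission
  imports Defs
begin

text \<open>
  Upper bound: take the constant words \<open>1, \<dots>, q\<close> as the first \<open>q\<close> vertices. A word escaping all of
  their balls contains each symbol so rarely that the multiplicities cannot add up to \<open>n\<close>.

  Lower bound: a word is the integral case of a choice of one probability distribution on the
  symbols per coordinate, and the uniform choice agrees with each given vertex in \<open>n / q\<close>
  coordinates in expectation. Impose these \<open>b\<close> expected agreements as linear equations and drop them
  one at a time, from the last vertex to the first. A nonnegative solution of small support under
  \<open>k\<close> remaining equations has at most \<open>k\<close> coordinates that are not yet deterministic, so that the
  agreement with vertex \<open>k\<close>, whose equation is dropped next, can grow by less than \<open>k\<close> in all later
  steps.
\<close>

section \<open>Nonnegative solutions of small support\<close>

text \<open>Gaussian elimination, one equation at a time: an equation that vanishes on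
  \<open>S\<close> is dropped; any other is solved for an unknown \<open>p\<close> with nonzero
  coefficient and substituted into the rest, which costs one equation and one unknown.\<close>

lemma homogeneous_system_nontrivial_solution:
  fixes c :: "'i \<Rightarrow> 's \<Rightarrow> 'f :: field"
  assumes "finite I" "finite S" "card I < card S"
  shows "\<exists>z. (\<exists>s\<in>S. z s \<noteq> 0) \<and> (\<forall>i\<in>I. (\<Sum>s\<in>S. c i s * z s) = 0)"
  using assms
proof (induction I arbitrary: S c rule: finite_induct)
  case empty
  then have "S \<noteq> {}" by auto
  then show ?case by (intro exI[of _ "\<lambda>_. 1"]) auto
next
  case (insert i I)
  show ?case
  proof (cases "\<exists>p\<in>S. c i p \<noteq> 0")
    case False
    have "card I < card S" using insert by simp
    then obtain z where "\<exists>s\<in>S. z s \<noteq> 0" "\<forall>i\<in>I. (\<Sum>s\<in>S. c i s * z s) = 0"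
      using insert.IH[OF insert.prems(1)] by blast
    moreover have "(\<Sum>s\<in>S. c i s * z s) = 0"
      using False by (intro sum.neutral) auto
    ultimately show ?thesis by blast
  next
    case True
    then obtain p where p: "p \<in> S" "c i p \<noteq> 0" by blast
    let ?S = "S - {p}"
    have "card I < card ?S" using insert p by simp
    then obtain z where z: "\<exists>s\<in>?S. z s \<noteq> 0"
        "\<forall>k\<in>I. (\<Sum>s\<in>?S. (c k s - c k p * c i s / c i p) * z s) = 0"
      using insert.IH[of ?S "\<lambda>k s. c k s - c k p * c i s / c i p"] insert.prems by auto
    \<comment> \<open>The value at \<open>p\<close> is the one that equation \<open>i\<close> forces
      on the solution \<open>z\<close> of the reduced system.\<close>
    define w where "w = z(p := - (\<Sum>s\<in>?S. c i s * z s) / c i p)"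
    have split: "(\<Sum>s\<in>S. c k s * w s) = c k p * w p + (\<Sum>s\<in>?S. c k s * z s)" for k
    proof -
      have "(\<Sum>s\<in>S. c k s * w s) = c k p * w p + (\<Sum>s\<in>?S. c k s * w s)"
        using insert.prems p by (simp add: sum.remove)
      moreover have "(\<Sum>s\<in>?S. c k s * w s) = (\<Sum>s\<in>?S. c k s * z s)"
        by (intro sum.cong) (auto simp: w_def)
      ultimately show ?thesis by simp
    qed
    have "(\<Sum>s\<in>S. c k s * w s) = 0" if k: "k \<in> I" for k
    proof -
      have "0 = (\<Sum>s\<in>?S. c k s * z s - (c k p / c i p) * (c i s * z s))"
        using z(2) k by (simp add: left_diff_distrib mult.assoc)
      also have "\<dots> = (\<Sum>s\<in>?S. c k s * z s) - (c k p / c i p) * (\<Sum>s\<in>?S. c i s * z s)"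
        by (simp add: sum_subtractf sum_distrib_left)
      finally show ?thesis unfolding split by (simp add: w_def)
    qed
    moreover have "(\<Sum>s\<in>S. c i s * w s) = 0"
      unfolding split using p by (simp add: w_def)
    moreover have "\<exists>s\<in>S. w s \<noteq> 0" using z(1) by (auto simp: w_def)
    ultimately show ?thesis by blast
  qed
qed

text \<open>This is the passage to a basic feasible solution in linear programming. While the
  support is larger than the number of equations, it carries a nonzero kernel vector; moving
  \<open>x\<close> along that vector until a coordinate reaches 0 shrinks the support and preserves
  all equations.\<close>

lemma nonneg_solution_small_support:
  fixes c :: "'i \<Rightarrow> 's \<Rightarrow> real" and x :: "'s \<Rightarrow> real"
  assumes "finite I" "finite S" "\<forall>s\<in>S. x s \<ge> 0"
  shows "\<exists>y. (\<forall>s\<in>S. y s \<ge> 0) \<and> {s\<in>S. y s > 0} \<subseteq> {s\<in>S. x s > 0} \<and>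
    (\<forall>i\<in>I. (\<Sum>s\<in>S. c i s * y s) = (\<Sum>s\<in>S. c i s * x s)) \<and> card {s\<in>S. y s > 0} \<le> card I"
  using assms(3)
proof (induction "card {s\<in>S. x s > 0}" arbitrary: x rule: less_induct)
  case less
  let ?T = "{s\<in>S. x s > 0}"
  show ?case
  proof (cases "card ?T \<le> card I")
    case True
    then show ?thesis using less.prems by (intro exI[of _ x]) auto
  next
    case False
    have finT: "finite ?T" using assms(2) by simp
    from False obtain z0 where z0: "\<exists>s\<in>?T. z0 s \<noteq> 0" "\<forall>i\<in>I. (\<Sum>s\<in>?T. c i s * z0 s) = 0"
      using homogeneous_system_nontrivial_solution[OF assms(1) finT, of c] by auto
    \<comment> \<open>The sign of the kernel vector is chosen so that some coordinate decreases;
      otherwise the motion might never reach the boundary.\<close>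
    obtain z where z: "\<exists>s\<in>?T. z s < 0" "\<forall>i\<in>I. (\<Sum>s\<in>?T. c i s * z s) = 0"
    proof (cases "\<exists>s\<in>?T. z0 s < 0")
      case True
      then show ?thesis using that z0 by blast
    next
      case False
      then have "\<exists>s\<in>?T. - z0 s < 0" using z0(1) by force
      moreover have "\<forall>i\<in>I. (\<Sum>s\<in>?T. c i s * - z0 s) = 0" using z0(2) by (simp add: sum_negf)
      ultimately show ?thesis using that[of "\<lambda>s. - z0 s"] by blast
    qed
    let ?N = "{s\<in>?T. z s < 0}"
    \<comment> \<open>Ratio test: \<open>t\<close> is the largest step that keeps every coordinate
      nonnegative, and a minimiser \<open>p\<close> leaves the support.\<close>
    define t where "t = Min ((\<lambda>s. x s / - z s) ` ?N)"
    have fin: "finite ((\<lambda>s. x s / - z s) ` ?N)" using finT by (intro finite_imageI finite_subset[OF _ finT]) auto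
    have ne: "(\<lambda>s. x s / - z s) ` ?N \<noteq> {}" using z(1) by blast
    obtain p where p: "p \<in> ?N" "t = x p / - z p"
      using Min_in[OF fin ne] unfolding t_def by blast
    have tle: "t \<le> x s / - z s" if "s \<in> ?N" for s
      unfolding t_def using fin that by (intro Min_le) auto
    have t0: "t \<ge> 0" using p by (auto intro!: divide_nonneg_pos simp del: divide_minus_right)
    define y where "y = (\<lambda>s. if s \<in> ?T then x s + t * z s else x s)"
    have y0: "\<forall>s\<in>S. y s \<ge> 0"
    proof
      fix s assume s: "s \<in> S"
      show "y s \<ge> 0"
      proof (cases "s \<in> ?N")
        case True
        then have "t * - z s \<le> x s" using tle[OF True] by (subst (asm) pos_le_divide_eq) auto
        then show ?thesis using True by (simp add: y_def)
      next
        case False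
        then show ?thesis using s less.prems t0 by (auto simp: y_def)
      qed
    qed
    have sub: "{s\<in>S. y s > 0} \<subseteq> ?T" by (auto simp: y_def)
    have "y p = 0" using p by (simp add: y_def)
    then have "{s\<in>S. y s > 0} \<subset> ?T" using sub p by force
    then have "card {s\<in>S. y s > 0} < card ?T" by (rule psubset_card_mono[OF finT])
    from less.hyps[OF this y0] obtain w where w: "\<forall>s\<in>S. w s \<ge> 0"
      "{s\<in>S. w s > 0} \<subseteq> {s\<in>S. y s > 0}"
      "\<forall>i\<in>I. (\<Sum>s\<in>S. c i s * w s) = (\<Sum>s\<in>S. c i s * y s)" "card {s\<in>S. w s > 0} \<le> card I"
      by blast
    have "(\<Sum>s\<in>S. c i s * y s) = (\<Sum>s\<in>S. c i s * x s)" if "i \<in> I" for i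
    proof -
      have "(\<Sum>s\<in>S. c i s * y s) = (\<Sum>s\<in>S. c i s * x s + (if s \<in> ?T then t * (c i s * z s) else 0))"
        by (intro sum.cong) (auto simp: y_def algebra_simps)
      also have "\<dots> = (\<Sum>s\<in>S. c i s * x s) + (\<Sum>s\<in>S \<inter> ?T. t * (c i s * z s))"
        using assms(2) by (simp only: sum.distrib sum.inter_restrict)
      also have "S \<inter> ?T = ?T" by blast
      also have "(\<Sum>s\<in>?T. t * (c i s * z s)) = 0"
        using z(2) that by (simp add: sum_distrib_left[symmetric])
      finally show ?thesis by simp
    qed
    then show ?thesis using w sub by (intro exI[of _ w]) auto
  qed
qed

section \<open>Rounding products of distributions\<close>

text \<open>There are \<open>card J\<close> normalisation equations and \<open>card K\<close>
  agreement equations, so some solution has at most \<open>card J + card K\<close> positive entries.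
  Each coordinate uses up at least one of them, which leaves at most \<open>card K\<close> for
  second symbols.\<close>

lemma product_distribution_few_random:
  fixes x :: "'j \<times> 'a \<Rightarrow> real" and v :: "'k \<Rightarrow> 'j \<Rightarrow> 'a"
  assumes fin: "finite J" "finite Q" "finite K"
    and v: "\<And>k j. k \<in> K \<Longrightarrow> j \<in> J \<Longrightarrow> v k j \<in> Q"
    and x: "\<forall>s\<in>J \<times> Q. x s \<ge> 0" "\<forall>j\<in>J. (\<Sum>a\<in>Q. x (j, a)) = 1"
  shows "\<exists>y. (\<forall>s\<in>J \<times> Q. y s \<ge> 0) \<and> (\<forall>j\<in>J. (\<Sum>a\<in>Q. y (j, a)) = 1) \<and>
    {s\<in>J \<times> Q. y s > 0} \<subseteq> {s\<in>J \<times> Q. x s > 0} \<and>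
    (\<forall>k\<in>K. (\<Sum>j\<in>J. y (j, v k j)) = (\<Sum>j\<in>J. x (j, v k j))) \<and>
    card {j\<in>J. card {a\<in>Q. y (j, a) > 0} \<ge> 2} \<le> card K"
proof -
  \<comment> \<open>Row \<open>Inl j\<close> is the total mass in coordinate \<open>j\<close>; row
    \<open>Inr k\<close> is the expected agreement with \<open>v k\<close>.\<close>
  define c :: "'j + 'k \<Rightarrow> 'j \<times> 'a \<Rightarrow> real" where
    "c = case_sum (\<lambda>j s. if fst s = j then 1 else 0) (\<lambda>k s. if v k (fst s) = snd s then 1 else 0)"
  have cell: "(\<Sum>s\<in>J \<times> Q. c (Inl j) s * w s) = (\<Sum>a\<in>Q. w (j, a))" if "j \<in> J" for j w
  proof -
    have "(\<Sum>s\<in>J \<times> Q. c (Inl j) s * w s) = (\<Sum>i\<in>J. \<Sum>a\<in>Q. if i = j then w (i, a) else 0)"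
      unfolding sum.cartesian_product by (intro sum.cong) (auto simp: c_def)
    also have "\<dots> = (\<Sum>i\<in>J. if i = j then \<Sum>a\<in>Q. w (i, a) else 0)"
      by (intro sum.cong) auto
    finally show ?thesis using fin that by simp
  qed
  have agree: "(\<Sum>s\<in>J \<times> Q. c (Inr k) s * w s) = (\<Sum>j\<in>J. w (j, v k j))" if "k \<in> K" for k w
  proof -
    have "(\<Sum>s\<in>J \<times> Q. c (Inr k) s * w s) = (\<Sum>j\<in>J. \<Sum>a\<in>Q. if v k j = a then w (j, a) else 0)"
      unfolding sum.cartesian_product by (intro sum.cong) (auto simp: c_def)
    also have "\<dots> = (\<Sum>j\<in>J. w (j, v k j))"
      by (intro sum.cong) (use fin v[OF that] in simp_all)
    finally show ?thesis .
  qed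
  obtain y where y: "\<forall>s\<in>J \<times> Q. y s \<ge> 0" "{s\<in>J \<times> Q. y s > 0} \<subseteq> {s\<in>J \<times> Q. x s > 0}"
    "\<forall>i\<in>J <+> K. (\<Sum>s\<in>J \<times> Q. c i s * y s) = (\<Sum>s\<in>J \<times> Q. c i s * x s)"
    "card {s\<in>J \<times> Q. y s > 0} \<le> card (J <+> K)"
    using nonneg_solution_small_support[of "J <+> K" "J \<times> Q" x c] fin x(1) by auto
  have y1: "(\<Sum>a\<in>Q. y (j, a)) = 1" if "j \<in> J" for j
    using bspec[OF y(3) InlI[OF that]] cell[OF that] x(2) that by simp
  have yK: "(\<Sum>j\<in>J. y (j, v k j)) = (\<Sum>j\<in>J. x (j, v k j))" if "k \<in> K" for k
    using bspec[OF y(3) InrI[OF that]] agree[OF that] by simp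
  let ?F = "{j\<in>J. card {a\<in>Q. y (j, a) > 0} \<ge> 2}"
  have pos: "card {a\<in>Q. y (j, a) > 0} \<ge> 1" if "j \<in> J" for j
  proof -
    have "\<exists>a\<in>Q. y (j, a) > 0"
    proof (rule ccontr)
      assume "\<not> ?thesis"
      then have "(\<Sum>a\<in>Q. y (j, a)) \<le> 0" by (intro sum_nonpos) force
      then show False using y1[OF that] by simp
    qed
    then have "{a\<in>Q. y (j, a) > 0} \<noteq> {}" by blast
    then show ?thesis using fin by (simp add: Suc_le_eq card_gt_0_iff)
  qed
  \<comment> \<open>The support is counted by coordinates: at least one symbol each, and at least
    two over \<open>?F\<close>.\<close>
  have "card J + card ?F = (\<Sum>j\<in>J. 1 + (if card {a\<in>Q. y (j, a) > 0} \<ge> 2 then 1 else 0))"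
    using fin by (subst sum.distrib) (simp flip: sum.inter_filter)
  also have "\<dots> \<le> (\<Sum>j\<in>J. card {a\<in>Q. y (j, a) > 0})"
    by (intro sum_mono) (use pos in auto)
  also have "\<dots> = card (SIGMA j:J. {a\<in>Q. y (j, a) > 0})"
    using fin by simp
  also have "(SIGMA j:J. {a\<in>Q. y (j, a) > 0}) = {s\<in>J \<times> Q. y s > 0}" by auto
  also have "card \<dots> \<le> card J + card K" using y(4) fin by (simp add: card_Plus)
  finally have "card ?F \<le> card K" by simp
  then show ?thesis using y(1,2) y1 yK by (intro exI[of _ y]) auto
qed

text \<open>Fixing a symbol of positive probability changes nothing in a deterministic coordinate.
  In a random one the agreement exceeds its expectation by less than 1, because an agreement can
  occur only where \<open>x (j, v j)\<close> is already positive.\<close>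

lemma support_choice_agreement_less:
  fixes x :: "'j \<times> 'a \<Rightarrow> real"
  assumes fin: "finite J" "finite Q"
    and v: "\<forall>j\<in>J. v j \<in> Q"
    and x: "\<forall>s\<in>J \<times> Q. x s \<ge> 0" "\<forall>j\<in>J. (\<Sum>a\<in>Q. x (j, a)) = 1"
    and few: "card {j\<in>J. card {a\<in>Q. x (j, a) > 0} \<ge> 2} \<le> m" "m > 0"
    and u: "\<forall>j\<in>J. u j \<in> Q \<and> x (j, u j) > 0"
  shows "real (card {j\<in>J. u j = v j}) < (\<Sum>j\<in>J. x (j, v j)) + real m"
proof -
  let ?F = "{j\<in>J. card {a\<in>Q. x (j, a) > 0} \<ge> 2}"
  have card_eq: "real (card {j\<in>J. u j = v j}) = (\<Sum>j\<in>J. if u j = v j then 1 else 0)"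
    using fin by (simp flip: sum.inter_filter)
  have strict: "(if u j = v j then 1 else 0) < x (j, v j) + 1" if "j \<in> J" for j
    using that u v x(1) by (auto simp: add_nonneg_pos add_pos_pos)
  \<comment> \<open>Outside \<open>?F\<close> a single symbol carries the whole mass, so agreement
    of \<open>u\<close> with \<open>v\<close> at \<open>j\<close> forces
    \<open>x (j, v j) = 1\<close>.\<close>
  have determined: "(if u j = v j then 1 else 0) \<le> x (j, v j)" if j: "j \<in> J" "j \<notin> ?F" for j
  proof (cases "u j = v j")
    case True
    have "x (j, a) = 0" if a: "a \<in> Q - {u j}" for a
    proof (rule ccontr)
      assume "x (j, a) \<noteq> 0"
      then have "{u j, a} \<subseteq> {a\<in>Q. x (j, a) > 0}"
        using a u j(1) x(1) by (auto simp: less_le)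
      then have "card {u j, a} \<le> card {a\<in>Q. x (j, a) > 0}"
        using fin by (intro card_mono) auto
      then show False using a j by auto
    qed
    then have "(\<Sum>a\<in>Q. x (j, a)) = x (j, u j)"
      using u j(1) fin by (simp add: sum.remove[of Q "u j"])
    then show ?thesis using x(2) j(1) True by simp
  next
    case False
    then show ?thesis using x(1) j(1) v by auto
  qed
  have le: "(if u j = v j then 1 else 0) \<le> x (j, v j) + (if j \<in> ?F then 1 else 0)" if "j \<in> J" for j
    using strict[OF that] determined[OF that] by (cases "j \<in> ?F") auto
  have total: "(\<Sum>j\<in>J. x (j, v j) + (if j \<in> ?F then 1 else 0)) = (\<Sum>j\<in>J. x (j, v j)) + real (card ?F)"
    using fin by (simp add: sum.distrib flip: sum.inter_filter)
  show ?thesis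
  \<comment> \<open>Strictness comes from a random coordinate if there is one, and from
    \<open>m > 0\<close> otherwise.\<close>
  proof (cases "?F = {}")
    case True
    have "real (card {j\<in>J. u j = v j}) \<le> (\<Sum>j\<in>J. x (j, v j)) + real (card ?F)"
      unfolding card_eq total[symmetric] by (intro sum_mono le)
    then show ?thesis using few(2) True by simp
  next
    case False
    have "real (card {j\<in>J. u j = v j}) < (\<Sum>j\<in>J. x (j, v j)) + real (card ?F)"
      unfolding card_eq total[symmetric]
    proof (rule sum_strict_mono_ex1)
      show "\<exists>j\<in>J. (if u j = v j then 1 else 0) < x (j, v j) + (if j \<in> ?F then 1 else 0)"
        using False strict by force
    qed (use fin le in auto)
    then show ?thesis using few(1) by linarith
  qed
qed

text \<open>The slack \<open>i + 1\<close> matches the radii of a burning sequence: with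
  \<open>n = card J\<close>, lying in the ball of radius \<open>b - 1 - i\<close> means at least
  \<open>n - b + i + 1\<close> agreements, so the threshold rises with \<open>i\<close> at the same
  rate as the bound.\<close>

lemma exists_choice_small_agreements:
  fixes v :: "nat \<Rightarrow> 'j \<Rightarrow> 'a"
  assumes fin: "finite J" "finite Q" "Q \<noteq> {}"
    and v: "\<And>i j. i < b \<Longrightarrow> j \<in> J \<Longrightarrow> v i j \<in> Q"
  shows "\<exists>u. (\<forall>j\<in>J. u j \<in> Q) \<and>
    (\<forall>i<b. real (card {j\<in>J. u j = v i j}) < real (card J) / real (card Q) + real (i + 1))"
proof -
  define dist where "dist x \<longleftrightarrow> (\<forall>s\<in>J \<times> Q. x s \<ge> 0) \<and> (\<forall>j\<in>J. (\<Sum>a\<in>Q. x (j, a)) = 1)"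
    for x :: "'j \<times> 'a \<Rightarrow> real"
  define supported where "supported x u \<longleftrightarrow> (\<forall>j\<in>J. u j \<in> Q \<and> x (j, u j) > 0)"
    for x :: "'j \<times> 'a \<Rightarrow> real" and u
  define few where "few x k \<longleftrightarrow> card {j\<in>J. card {a\<in>Q. x (j, a) > 0} \<ge> 2} \<le> k"
    for x :: "'j \<times> 'a \<Rightarrow> real" and k
  let ?r = "real (card J) / real (card Q)"
  have cardQ: "card Q > 0" using fin by (simp add: card_gt_0_iff)
  \<comment> \<open>Rounding under the first \<open>k\<close> equations leaves at most
    \<open>k\<close> random coordinates. Supports only shrink, so a bound proved for all choices
    supported by \<open>x\<close> passes on to \<open>y\<close>.\<close>
  have reduce: "\<exists>y. dist y \<and> few y k \<and> (\<forall>u. supported y u \<longrightarrow> supported x u) \<and>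
      (\<forall>i<k. (\<Sum>j\<in>J. y (j, v i j)) = ?r)"
    if x: "dist x" "\<forall>i<k. (\<Sum>j\<in>J. x (j, v i j)) = ?r" and k: "k \<le> b" for x k
  proof -
    obtain y where y: "\<forall>s\<in>J \<times> Q. y s \<ge> 0" "\<forall>j\<in>J. (\<Sum>a\<in>Q. y (j, a)) = 1"
      "{s\<in>J \<times> Q. y s > 0} \<subseteq> {s\<in>J \<times> Q. x s > 0}"
      "\<forall>i\<in>{..<k}. (\<Sum>j\<in>J. y (j, v i j)) = (\<Sum>j\<in>J. x (j, v i j))"
      "card {j\<in>J. card {a\<in>Q. y (j, a) > 0} \<ge> 2} \<le> card {..<k}"
      using product_distribution_few_random[of J Q "{..<k}" v x] fin v k x(1)
      unfolding dist_def by auto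
    have "supported x u" if "supported y u" for u
      using that y(3) unfolding supported_def by blast
    then show ?thesis
      using y x(2) by (intro exI[of _ y]) (auto simp: dist_def few_def)
  qed
  \<comment> \<open>Downward induction on the number \<open>k\<close> of equations still imposed.
    Words with index below \<open>k\<close> keep their exact expected agreement; those from
    \<open>k\<close> on are bounded for every supported choice, a property that survives all later
    roundings.\<close>
  have "\<exists>x. dist x \<and> few x k \<and> (\<forall>i<k. (\<Sum>j\<in>J. x (j, v i j)) = ?r) \<and>
      (\<forall>u i. supported x u \<longrightarrow> k \<le> i \<longrightarrow> i < b \<longrightarrow>
        real (card {j\<in>J. u j = v i j}) < ?r + real (i + 1))" if "k \<le> b" for k
    using that
  proof (induction k rule: inc_induct)
    case base
    \<comment> \<open>The uniform distribution has expected agreement \<open>?r\<close> with every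
      word.\<close>
    let ?x = "\<lambda>_ :: 'j \<times> 'a. 1 / real (card Q)"
    have "dist ?x" using cardQ by (simp add: dist_def)
    moreover have "\<forall>i<b. (\<Sum>j\<in>J. ?x (j, v i j)) = ?r" by simp
    ultimately obtain y where "dist y" "few y b" "\<forall>i<b. (\<Sum>j\<in>J. y (j, v i j)) = ?r"
      using reduce[of ?x b] by blast
    then show ?case by (intro exI[of _ y]) auto
  next
    case (step k)
    then obtain x where x: "dist x" "few x (Suc k)" "\<forall>i<Suc k. (\<Sum>j\<in>J. x (j, v i j)) = ?r"
      "\<And>u i. supported x u \<Longrightarrow> Suc k \<le> i \<Longrightarrow> i < b \<Longrightarrow>
        real (card {j\<in>J. u j = v i j}) < ?r + real (i + 1)"
      by blast
    \<comment> \<open>Equation \<open>k\<close> is used here for the last time: it still holds for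
      \<open>x\<close>, which has at most \<open>k + 1\<close> random coordinates.\<close>
    have new: "real (card {j\<in>J. u j = v k j}) < ?r + real (k + 1)" if "supported x u" for u
      using support_choice_agreement_less[of J Q "v k" x "Suc k" u] fin v step.hyps x that
      unfolding dist_def few_def supported_def by auto
    obtain y where y: "dist y" "few y k" "\<forall>u. supported y u \<longrightarrow> supported x u"
      "\<forall>i<k. (\<Sum>j\<in>J. y (j, v i j)) = ?r"
      using reduce[of x k] x(1,3) step.hyps by auto
    have "real (card {j\<in>J. u j = v i j}) < ?r + real (i + 1)"
      if "supported y u" "k \<le> i" "i < b" for u i
      using that y(3) new x(4) by (cases "i = k") auto
    then show ?case using y by blast
  qed
  from this[of 0] obtain x where x: "dist x"
    "\<And>u i. supported x u \<Longrightarrow> i < b \<Longrightarrow> real (card {j\<in>J. u j = v i j}) < ?r + real (i + 1)"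
    by auto
  \<comment> \<open>Masses that sum to 1 are not all zero, so a supported choice exists.\<close>
  have "\<exists>a\<in>Q. x (j, a) > 0" if "j \<in> J" for j
  proof (rule ccontr)
    assume "\<not> ?thesis"
    then have "(\<Sum>a\<in>Q. x (j, a)) \<le> 0" by (intro sum_nonpos) force
    then show False using x(1) that by (simp add: dist_def)
  qed
  then obtain u where "supported x u" unfolding supported_def by metis
  then show ?thesis using x(2) by (intro exI[of _ u]) (auto simp: supported_def)
qed

section \<open>Burning sequences of Hamming graphs\<close>

lemma burning_sequence_hamming_graph_iff:
  fixes n q :: nat
  defines "V \<equiv> {u. length u = n \<and> set u \<subseteq> {1..q}}"
  shows "graph.burning_sequence (with_proj (hamming_graph n q)) vs \<longleftrightarrow>
    set vs \<subseteq> V \<and> (\<forall>u\<in>V. \<exists>i<length vs. hamming_dist (vs ! i) u \<le> length vs - 1 - i)"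
proof -
  interpret graph "with_proj (hamming_graph n q)" by (rule graph_hamming_graph)
  have V: "pverts (hamming_graph n q) = V" by (simp add: hamming_graph_def V_def)
  have ball: "graph_ball k w = {u\<in>V. hamming_dist w u \<le> k}" if "w \<in> V" for k w
    using that unfolding graph_ball_def with_proj_simps V
    by (auto simp: graph_dist_hamming_graph V)
  show ?thesis
  \<comment> \<open>\<open>ball\<close> describes only balls centred at vertices; if some entry is
    not a vertex, both sides fail.\<close>
  proof (cases "set vs \<subseteq> V")
    case True
    then have "(\<Union>i<length vs. graph_ball (length vs - 1 - i) (vs ! i)) =
        {u\<in>V. \<exists>i<length vs. hamming_dist (vs ! i) u \<le> length vs - 1 - i}"
      using ball by (auto simp: subset_iff)
    then show ?thesis using True unfolding burning_sequence_def with_proj_simps V by auto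
  qed (simp add: burning_sequence_def V)
qed

lemma card_agreements:
  assumes "length u = n"
  shows "int (card {j. j < n \<and> v ! j = u ! j}) = int n - int (hamming_dist u v)"
proof -
  have "{j. j < n \<and> v ! j = u ! j} \<union> {j. j < n \<and> u ! j \<noteq> v ! j} = {..<n}" by auto
  moreover have "card ({j. j < n \<and> v ! j = u ! j} \<union> {j. j < n \<and> u ! j \<noteq> v ! j}) =
      card {j. j < n \<and> v ! j = u ! j} + card {j. j < n \<and> u ! j \<noteq> v ! j}"
    by (intro card_Un_disjoint) auto
  ultimately show ?thesis using assms by (simp add: hamming_dist_def)
qed

text \<open>This is the lower bound cleared of fractions. Were the sequence shorter, the choice of
  symbols with few agreements would be a word outside all the balls.\<close>

lemma burning_sequence_hamming_graph_length:
  assumes "q > 0" "graph.burning_sequence (with_proj (hamming_graph n q)) vs"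
  shows "(q - 1) * n < q * length vs"
proof (rule ccontr)
  assume "\<not> ?thesis"
  then have "int (q * length vs) \<le> int ((q - 1) * n)" by (simp only: not_less of_nat_le_iff)
  then have small: "int q * int (length vs) \<le> (int q - 1) * int n"
    using assms(1) by (simp add: of_nat_diff)
  let ?b = "length vs"
  from assms(2) have "set vs \<subseteq> {u. length u = n \<and> set u \<subseteq> {1..q}}"
    and cover: "\<forall>u. length u = n \<and> set u \<subseteq> {1..q} \<longrightarrow>
      (\<exists>i<?b. hamming_dist (vs ! i) u \<le> ?b - 1 - i)"
    unfolding burning_sequence_hamming_graph_iff by auto
  then have vs: "\<forall>i<?b. length (vs ! i) = n \<and> set (vs ! i) \<subseteq> {1..q}"
    by (auto dest: nth_mem)
  have "vs ! i ! j \<in> {1..q}" if "i < ?b" "j \<in> {..<n}" for i j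
  proof -
    have "vs ! i ! j \<in> set (vs ! i)" using vs that by auto
    then show ?thesis using vs that by blast
  qed
  then have "\<exists>f. (\<forall>j\<in>{..<n}. f j \<in> {1..q}) \<and> (\<forall>i<?b.
      real (card {j\<in>{..<n}. f j = vs ! i ! j}) < real (card {..<n}) / real (card {1..q}) + real (i + 1))"
    using assms(1) by (intro exists_choice_small_agreements[where v = "\<lambda>i j. vs ! i ! j"]) simp_all
  then obtain f where f: "\<forall>j\<in>{..<n}. f j \<in> {1..q}"
    "\<forall>i<?b. real (card {j\<in>{..<n}. f j = vs ! i ! j}) < real n / real q + real (i + 1)"
    unfolding card_lessThan card_atLeastAtMost diff_Suc_1 by blast
  let ?u = "map f [0..<n]"
  have "length ?u = n \<and> set ?u \<subseteq> {1..q}"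
    using f(1) by (simp add: image_subset_iff atLeast0LessThan)
  then obtain i where i: "i < ?b" "hamming_dist (vs ! i) ?u \<le> ?b - 1 - i" using cover[rule_format, of ?u] by blast
  define m where "m = card {j\<in>{..<n}. f j = vs ! i ! j}"
  have "{j\<in>{..<n}. f j = vs ! i ! j} = {j. j < n \<and> ?u ! j = vs ! i ! j}" by auto
  then have m: "int m = int n - int (hamming_dist (vs ! i) ?u)"
    using card_agreements[of "vs ! i" n ?u] vs i(1) by (simp add: m_def)
  have "real m < real n / real q + real (i + 1)" using f(2) i(1) by (simp add: m_def)
  then have "real m * real q < real n + real (i + 1) * real q"
    using assms(1) by (simp add: field_simps)
  then have "real (m * q) < real (n + (i + 1) * q)"
    by (simp only: of_nat_add of_nat_mult)
  then have "int (m * q) < int (n + (i + 1) * q)" by (simp only: of_nat_less_iff)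
  then have "int m * int q < int n + int (i + 1) * int q"
    by (simp only: of_nat_add of_nat_mult)
  \<comment> \<open>The ball containing \<open>?u\<close> forces at least
    \<open>n - ?b + 1 + i\<close> agreements. Against the upper bound on \<open>m\<close> the terms
    in \<open>i + 1\<close> cancel, which leaves \<open>(n - ?b) * q < n\<close>.\<close>
  moreover have "(int n - int ?b + 1 + int i) * int q \<le> int m * int q"
    using m i by (intro mult_right_mono) auto
  ultimately show False using small by (simp add: algebra_simps)
qed

text \<open>Hypothesis \<open>b\<close> says that the length exceeds
  \<open>(1 - 1/q) n + (q - 1)/2\<close>. If \<open>u\<close> escaped, each symbol
  \<open>c + 1\<close> would occur at most \<open>n - b + c\<close> times; summing over
  \<open>c < q\<close> gives too few letters for a word of length \<open>n\<close>. Positions from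
  \<open>q\<close> on hold an arbitrary filler word.\<close>

lemma constant_words_burning_sequence:
  assumes q: "q > 0" and b: "2 * (int q - 1) * int n + int q * (int q - 1) < 2 * int q * int b"
  shows "graph.burning_sequence (with_proj (hamming_graph n q))
    (map (\<lambda>i. replicate n (if i < q then i + 1 else 1)) [0..<b])"
    (is "graph.burning_sequence _ ?vs")
  unfolding burning_sequence_hamming_graph_iff
proof (intro conjI ballI)
  show "set ?vs \<subseteq> {u. length u = n \<and> set u \<subseteq> {1..q}}" using q by auto
  fix u assume "u \<in> {u. length u = n \<and> set u \<subseteq> {1..q}}"
  then have u: "length u = n" "set u \<subseteq> {1..q}" by auto
  define m where "m c = card {j. j < n \<and> u ! j = Suc c}" for c
  have "(\<Sum>c<q. m c) = card (\<Union>c<q. {j. j < n \<and> u ! j = Suc c})"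
    unfolding m_def by (intro card_UN_disjoint[symmetric]) auto
  also have "(\<Union>c<q. {j. j < n \<and> u ! j = Suc c}) = {..<n}"
  proof -
    have "\<exists>c<q. u ! j = Suc c" if "j < n" for j
    proof -
      have "u ! j \<in> {1..q}" using u that nth_mem[of j u] by blast
      then show ?thesis by (intro exI[of _ "u ! j - 1"]) auto
    qed
    then show ?thesis by auto
  qed
  finally have total: "(\<Sum>c<q. int (m c)) = int n" by (simp flip: of_nat_sum)
  have "\<exists>c<q. int (m c) > int n - int b + int c"
  proof (rule ccontr)
    assume "\<not> ?thesis"
    then have "(\<Sum>c<q. int (m c)) \<le> (\<Sum>c<q. int n - int b + int c)"
      by (intro sum_mono) force
    also have "\<dots> = int q * (int n - int b) + (\<Sum>c<q. int c)" by (simp add: sum.distrib)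
    finally have "int n \<le> int q * (int n - int b) + (\<Sum>c<q. int c)" using total by simp
    moreover have "2 * (\<Sum>c<q. int c) = int q * (int q - 1)"
      by (induction q) (auto simp: algebra_simps)
    ultimately show False using b by (simp add: algebra_simps)
  qed
  then obtain c where c: "c < q" "int (m c) > int n - int b + int c" by blast
  have "m c \<le> n" unfolding m_def using card_mono[of "{..<n}" "{j. j < n \<and> u ! j = Suc c}"] by auto
  \<comment> \<open>The count ran over all \<open>q\<close> symbols even if \<open>b < q\<close>;
    the symbol found still has its constant word in the list, since \<open>c \<ge> b\<close> would
    require more than \<open>n\<close> occurrences.\<close>
  then have cb: "c < b" using c by linarith
  have "{j. j < n \<and> u ! j = replicate n (Suc c) ! j} = {j. j < n \<and> u ! j = Suc c}" by auto
  then have "int (m c) = int n - int (hamming_dist (replicate n (Suc c)) u)"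
    using card_agreements[of "replicate n (Suc c)" n u] by (simp add: m_def)
  then show "\<exists>i<length ?vs. hamming_dist (?vs ! i) u \<le> length ?vs - 1 - i"
    using c cb by (intro exI[of _ c]) auto
qed

theorem theorem1p2:
  fixes q n :: nat
  assumes "q \<ge> 3" and "n \<ge> 1"
  shows "\<lfloor>(1 - 1 / real q) * real n\<rfloor> + 1
           \<le> int (graph.burning_number (with_proj (hamming_graph n q)))
       \<and> int (graph.burning_number (with_proj (hamming_graph n q)))
           \<le> \<lfloor>(1 - 1 / real q) * real n + (real q + 1) / 2\<rfloor>"
proof
  interpret graph "with_proj (hamming_graph n q)" by (rule graph_hamming_graph)
  have q: "q > 0" using assms by simp
  obtain vs where vs: "burning_sequence vs" "length vs = burning_number"
    using burning_number_attained by blast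
  have "real ((q - 1) * n) < real (q * burning_number)"
    using burning_sequence_hamming_graph_length[OF q vs(1)] vs(2) by (simp only: of_nat_less_iff)
  then have "(1 - 1 / real q) * real n < real burning_number"
    using q by (simp add: field_simps of_nat_diff)
  \<comment> \<open>An integer strictly above a real is at least its floor plus 1.\<close>
  then show "\<lfloor>(1 - 1 / real q) * real n\<rfloor> + 1 \<le> int burning_number"
    by linarith
  define x where "x = (1 - 1 / real q) * real n + (real q + 1) / 2"
  define b where "b = nat \<lfloor>x\<rfloor>"
  have "x \<ge> 0" using q by (auto simp: x_def intro!: add_nonneg_nonneg mult_nonneg_nonneg)
  then have b: "int b = \<lfloor>x\<rfloor>" by (simp add: b_def)
  \<comment> \<open>Since \<open>(q + 1)/2 = (q - 1)/2 + 1\<close>, this is exactly the strict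
    length condition for the constant words.\<close>
  then have "x < real b + 1" by linarith
  then have "2 * real q * x < 2 * real q * (real b + 1)" using q by simp
  moreover have "2 * real q * x = 2 * (real q - 1) * real n + real q * (real q + 1)"
    using q by (simp add: x_def field_simps)
  ultimately have "real_of_int (2 * (int q - 1) * int n + int q * (int q - 1)) < real_of_int (2 * int q * int b)"
    by (simp add: algebra_simps)
  then have "2 * (int q - 1) * int n + int q * (int q - 1) < 2 * int q * int b"
    by (simp only: of_int_less_iff)
  from constant_words_burning_sequence[OF q this]
  have "burning_number \<le> b" unfolding burning_number_def by (intro Least_le) force
  then show "int burning_number \<le> \<lfloor>(1 - 1 / real q) * real n + (real q + 1) / 2\<rfloor>"
    using b by (simp add: x_def)
qed

end
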